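(* Let $\{X_i\}_{i\ge1}$ be i.i.d. real random variables with distribution $F$, and for $n\ge 2$ let $T_n$ be the $t$-statistic of $X_1,\ldots,X_n$. For any integer $n\ge 2$ and any real $r>0$, if $\mathrm{E}|T_n|^r$ is finite, then $\mathrm{E}|T_{n+1}|^r$ is finite.
   Context: For $n\ge2$ set $S_n=\sum_{i=1}^n X_i$ and $\hat\sigma_n^2=\frac{1}{n-1}\sum_{i=1}^n (X_i-n^{-1}S_n)^2$, with $\hat\sigma_n\ge 0$. The $t$-statistic is $T_n=n^{-1/2}\hat\sigma_n^{-1}S_n$ if $\hat\sigma_n>0$ and $T_n=0$ if $\hat\sigma_n=0$. *)

theory Defs
  imports "HOL-Probability.Probability"
begin

definition partial_sum :: "nat \<Rightarrow> (nat \<Rightarrow> real) \<Rightarrow> real" where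
  "partial_sum n x = (\<Sum>i=1..n. x i)"

definition sample_sd :: "nat \<Rightarrow> (nat \<Rightarrow> real) \<Rightarrow> real" where
  "sample_sd n x = sqrt (1 / (real n - 1) * (\<Sum>i=1..n. (x i - partial_sum n x / real n)\<^sup>2))"

text \<open>The samples are indexed from 1: the entry \<open>x 0\<close> is never used.
  The definitions are meant for \<open>n \<ge> 2\<close>.\<close>

definition t_statistic :: "nat \<Rightarrow> (nat \<Rightarrow> real) \<Rightarrow> real" where
  "t_statistic n x =
     (if sample_sd n x > 0 then partial_sum n x / (sqrt (real n) * sample_sd n x) else 0)"

end

theory Submission
  imports Defs
begin

text \<open>If a sample of size \<open>n + 1\<close> is not constant, some subsample of size \<open>n\<close> (omitting the first
  or the last observation) is not constant either. Its mean differs from the mean of the full sample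
  by at most a multiple of the full standard deviation, and its standard deviation is at most a
  multiple of the full one; hence \<open>\<bar>T\<^bsub>n+1\<^esub>\<bar>\<close> is bounded by a multiple of \<open>1 + \<bar>T\<bar>\<close>, where \<open>T\<close> is the
  \<open>t\<close>-statistic of the subsample. By the i.i.d. assumption, \<open>T\<close> has the law of \<open>T\<^sub>n\<close>.\<close>

section \<open>Pathwise comparison of samples of sizes \<open>n\<close> and
  \<open>n + 1\<close>\<close>

lemma sample_sd_sq:
  assumes "n \<ge> 2"
  shows "(sample_sd n x)\<^sup>2 * (real n - 1) = (\<Sum>i=1..n. (x i - partial_sum n x / real n)\<^sup>2)"
  using assms by (simp add: sample_sd_def sum_nonneg)

lemma sample_sd_nonneg: "n \<ge> 1 \<Longrightarrow> 0 \<le> sample_sd n x"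
  by (simp add: sample_sd_def sum_nonneg)

lemma sample_sd_eq_0_iff:
  assumes "n \<ge> 2"
  shows "sample_sd n x = 0 \<longleftrightarrow> (\<forall>i\<in>{1..n}. x i = x 1)"
proof
  assume "sample_sd n x = 0"
  then have "(\<Sum>i=1..n. (x i - partial_sum n x / real n)\<^sup>2) = 0"
    using sample_sd_sq[OF assms, of x] by simp
  then have "\<forall>i\<in>{1..n}. (x i - partial_sum n x / real n)\<^sup>2 = 0"
    by (subst (asm) sum_nonneg_eq_0_iff) auto
  then have "\<forall>i\<in>{1..n}. x i = partial_sum n x / real n"
    by simp
  then show "\<forall>i\<in>{1..n}. x i = x 1"
    using assms by simp
next
  assume "\<forall>i\<in>{1..n}. x i = x 1"
  then obtain c where const: "\<forall>i\<in>{1..n}. x i = c" by blast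
  then have "partial_sum n x = real n * c"
    by (simp add: partial_sum_def)
  then show "sample_sd n x = 0"
    using const assms by (simp add: sample_sd_def)
qed

text \<open>Isolating the ratio of mean to standard deviation leaves a factor that depends on the
  sample size only, so that samples of different sizes can be compared.\<close>

lemma abs_t_statistic:
  assumes "n \<ge> 2" "sample_sd n x > 0"
  shows "\<bar>t_statistic n x\<bar> = sqrt (real n) * (\<bar>partial_sum n x / real n\<bar> / sample_sd n x)"
proof -
  have "real n = sqrt (real n) * sqrt (real n)" by simp
  then have "1 / sqrt (real n) = sqrt (real n) / real n"
    using assms(1) by (simp add: field_simps)
  then show ?thesis
    using assms by (simp add: t_statistic_def abs_mult field_simps)
qed

text \<open>The cross term vanishes at the mean, so the two sums differ by exactly
  \<open>real n * (m - c)\<^sup>2\<close>. It is applied with \<open>c\<close> the mean of a larger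
  sample.\<close>

lemma sum_sq_partial_mean_le:
  assumes "n \<ge> 1"
  shows "(\<Sum>i=1..n. (x i - partial_sum n x / real n)\<^sup>2) \<le> (\<Sum>i=1..n. (x i - c)\<^sup>2)"
proof -
  define m where "m = partial_sum n x / real n"
  have "(\<Sum>i=1..n. x i) = real n * m"
    using assms by (simp add: m_def partial_sum_def)
  then have "(\<Sum>i=1..n. (x i - c)\<^sup>2) - (\<Sum>i=1..n. (x i - m)\<^sup>2) = real n * (m - c)\<^sup>2"
    by (simp add: power2_diff sum.distrib sum_subtractf flip: sum_distrib_left sum_distrib_right)
       (simp add: power2_eq_square algebra_simps)
  then show ?thesis
    unfolding m_def by (smt (verit) mult_nonneg_nonneg of_nat_0_le_iff zero_le_power2)
qed

text \<open>Hypothesis \<open>sub\<close> encodes that the sample \<open>x\<close> is, up to order,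
  the sample \<open>y\<close> with \<open>z\<close> added. This form covers the omission of any one
  observation, and the proof applies it to the identity and to the squared deviation from the full
  mean.\<close>

lemma t_statistic_add_observation:
  fixes x y :: "nat \<Rightarrow> real"
  assumes n: "n \<ge> 2"
    and sub: "\<And>g :: real \<Rightarrow> real. (\<Sum>i=1..n. g (y i)) + g z = (\<Sum>i=1..n+1. g (x i))"
    and pos: "sample_sd n y > 0"
  shows "\<bar>t_statistic (n + 1) x\<bar> \<le> real (n + 1) * (1 + \<bar>t_statistic n y\<bar>)"
proof (cases "sample_sd (n + 1) x > 0")
  case False
  then show ?thesis by (simp add: t_statistic_def)
next
  case True
  define s where "s = sample_sd (n + 1) x"
  define s' where "s' = sample_sd n y"
  define m where "m = partial_sum (n + 1) x / real (n + 1)"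
  define m' where "m' = partial_sum n y / real n"
  have s: "s > 0" "s' > 0" using True pos by (auto simp: s_def s'_def)
  have V: "s\<^sup>2 * real n = (\<Sum>i=1..n+1. (x i - m)\<^sup>2)"
    using sample_sd_sq[of "n + 1" x] n unfolding s_def m_def by simp
  have V': "s'\<^sup>2 * (real n - 1) = (\<Sum>i=1..n. (y i - m')\<^sup>2)"
    using sample_sd_sq[OF n, of y] by (simp add: s'_def m'_def)
  have split: "(\<Sum>i=1..n. (y i - m)\<^sup>2) + (z - m)\<^sup>2 = s\<^sup>2 * real n"
    using sub[of "\<lambda>t. (t - m)\<^sup>2"] V by simp
  have "(z - m)\<^sup>2 \<le> s\<^sup>2 * real n"
    using split sum_nonneg[of "{1..n}" "\<lambda>i. (y i - m)\<^sup>2"] by simp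
  \<comment> \<open>The factor \<open>real n\<close> is weakened to its square so that, after the
    root, it cancels against the one in \<open>real n * (m - m') = z - m\<close>.\<close>
  also have "\<dots> \<le> (s * real n)\<^sup>2"
    unfolding power_mult_distrib using n
    by (intro mult_left_mono) (simp_all add: power2_eq_square)
  finally have "\<bar>z - m\<bar> \<le> s * real n"
    using s abs_le_square_iff[of "z - m" "s * real n"] by simp
  moreover have "real (n + 1) * m = real n * m' + z"
    using sub[of "\<lambda>t. t"] n by (simp add: m_def m'_def partial_sum_def)
  then have "real n * (m - m') = z - m"
    by (simp add: algebra_simps)
  then have "real n * \<bar>m - m'\<bar> = \<bar>z - m\<bar>"
    by (metis abs_mult abs_of_nat)
  ultimately have "real n * \<bar>m - m'\<bar> \<le> real n * s"
    by (simp add: mult.commute)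
  then have mean: "\<bar>m\<bar> \<le> \<bar>m'\<bar> + s"
    using n by (simp add: mult_le_cancel_left)
  \<comment> \<open>Here \<open>n \<ge> 2\<close> gives \<open>real n - 1 \<ge> 1\<close>. Replacing
    \<open>m'\<close> by \<open>m\<close> then only increases the sum of squares, which is part of
    the full one by \<open>split\<close>.\<close>
  have "s'\<^sup>2 \<le> s'\<^sup>2 * (real n - 1)"
    using n by (simp add: mult_left_le[of 1] mult_le_cancel_left1)
  also have "\<dots> \<le> s\<^sup>2 * real n"
    using V' split sum_sq_partial_mean_le[of n y m] n unfolding m'_def
    by (smt (verit) zero_le_power2 le_trans one_le_numeral)
  also have "\<dots> \<le> (sqrt (real n) * s)\<^sup>2"
    by (simp add: power_mult_distrib mult.commute)
  finally have sd: "s' \<le> sqrt (real n) * s"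
    by (rule power2_le_imp_le) (use s in simp)
  have "\<bar>m\<bar> / s \<le> \<bar>m'\<bar> / s + 1"
    using mean s by (simp add: field_simps)
  moreover have "\<bar>m'\<bar> / s \<le> sqrt (real n) * (\<bar>m'\<bar> / s')"
  proof -
    have "\<bar>m'\<bar> * s' \<le> \<bar>m'\<bar> * (sqrt (real n) * s)"
      using sd by (rule mult_left_mono) simp
    then show ?thesis
      using s by (simp add: field_simps)
  qed
  moreover have "sqrt (real n) * (\<bar>m'\<bar> / s') = \<bar>t_statistic n y\<bar>"
    using abs_t_statistic[OF n pos] by (simp add: m'_def s'_def)
  ultimately have bd: "\<bar>m\<bar> / s \<le> 1 + \<bar>t_statistic n y\<bar>" by simp
  have "\<bar>t_statistic (n + 1) x\<bar> = sqrt (real (n + 1)) * (\<bar>m\<bar> / s)"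
    using abs_t_statistic[of "n + 1" x] n True unfolding m_def s_def by simp
  also have "\<dots> \<le> real (n + 1) * (1 + \<bar>t_statistic n y\<bar>)"
  proof (intro mult_mono bd)
    show "sqrt (real (n + 1)) \<le> real (n + 1)"
      by (intro real_le_lsqrt) (simp_all add: power2_eq_square)
  qed (use s in auto)
  finally show ?thesis .
qed

text \<open>The update drops the first observation and stores the last one in the free slot 1; the
  order of the observations is irrelevant.\<close>

lemma t_statistic_Suc_le:
  fixes x :: "nat \<Rightarrow> real"
  assumes n: "n \<ge> 2"
  shows "\<bar>t_statistic (n + 1) x\<bar>
    \<le> real (n + 1) * (1 + max \<bar>t_statistic n x\<bar> \<bar>t_statistic n (x(1 := x (n + 1)))\<bar>)"
proof -
  define y where "y = x(1 := x (n + 1))"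
  have nonneg: "sample_sd n x \<ge> 0" "sample_sd n y \<ge> 0"
    using n by (simp_all add: sample_sd_nonneg)
  have mono: "real (n + 1) * (1 + a) \<le> real (n + 1) * (1 + b)" if "a \<le> b" for a b
    using that by (intro mult_left_mono) auto
  consider "sample_sd n x > 0" | "sample_sd n y > 0"
    | "sample_sd n x = 0" "sample_sd n y = 0"
    using nonneg by linarith
  then show ?thesis
  proof cases
    case 1
    have "(\<Sum>i=1..n. g (x i)) + g (x (n + 1)) = (\<Sum>i=1..n+1. g (x i))" for g :: "real \<Rightarrow> real"
      by simp
    from t_statistic_add_observation[OF n this 1] show ?thesis
      by (rule order_trans[OF _ mono]) simp
  next
    case 2
    have "(\<Sum>i=1..n. g (y i)) + g (x 1) = (\<Sum>i=1..n+1. g (x i))" for g :: "real \<Rightarrow> real"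
    proof -
      have "(\<Sum>i=2..n. g (y i)) = (\<Sum>i=2..n. g (x i))"
        by (rule sum.cong) (auto simp: y_def)
      then show ?thesis
        using n by (simp add: sum.atLeast_Suc_atMost numeral_2_eq_2 y_def)
    qed
    from t_statistic_add_observation[OF n this 2] show ?thesis
      unfolding y_def by (rule order_trans[OF _ mono]) simp
  next
    case 3
    have x: "\<forall>i\<in>{1..n}. x i = x 1"
      using sample_sd_eq_0_iff[OF n] 3(1) by (rule iffD1)
    have "\<forall>i\<in>{1..n}. y i = y 1"
      using sample_sd_eq_0_iff[OF n] 3(2) by (rule iffD1)
    \<comment> \<open>As \<open>n \<ge> 2\<close>, the observation \<open>x 2\<close> lies in both
      constant subsamples and forces their values to agree. The full sample is then constant, and
      its statistic is 0 by convention.\<close>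
    then have "y 2 = y 1" by (rule bspec) (use n in simp)
    then have "x (n + 1) = x 2" by (simp add: y_def)
    also have "x 2 = x 1" using x by (rule bspec) (use n in simp)
    finally have "\<forall>i\<in>insert (n + 1) {1..n}. x i = x 1"
      using x by blast
    then have "\<forall>i\<in>{1..n + 1}. x i = x 1"
      by (simp only: atLeastAtMostSuc_conv Suc_eq_plus1[symmetric] le_add2)
    then have "sample_sd (n + 1) x = 0"
      by (rule sample_sd_eq_0_iff[THEN iffD2, rotated]) (use n in simp)
    then show ?thesis by (simp add: t_statistic_def)
  qed
qed

section \<open>Measurability and invariance of the law under reindexing\<close>

lemma t_statistic_cong:
  assumes "\<And>i. i \<in> {1..n} \<Longrightarrow> x i = y i"
  shows "t_statistic n x = t_statistic n y"
proof -
  have "partial_sum n x = partial_sum n y"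
    unfolding partial_sum_def using assms by (rule sum.cong[OF refl])
  moreover from this have "sample_sd n x = sample_sd n y"
    unfolding sample_sd_def using assms by simp
  ultimately show ?thesis by (simp add: t_statistic_def)
qed

lemma measurable_t_statistic [measurable (raw)]:
  assumes "\<And>i. i \<in> {1..n} \<Longrightarrow> X i \<in> borel_measurable M"
  shows "(\<lambda>\<omega>. t_statistic n (\<lambda>i. X i \<omega>)) \<in> borel_measurable M"
proof -
  have S [measurable]: "(\<lambda>\<omega>. partial_sum n (\<lambda>i. X i \<omega>)) \<in> borel_measurable M"
    unfolding partial_sum_def using assms by (rule borel_measurable_sum)
  have [measurable]: "(\<lambda>\<omega>. sample_sd n (\<lambda>i. X i \<omega>)) \<in> borel_measurable M"
    unfolding sample_sd_def
    by (intro borel_measurable_sqrt[THEN measurable_compose_rev] borel_measurable_times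
        borel_measurable_const borel_measurable_sum borel_measurable_power
        borel_measurable_diff assms borel_measurable_divide S) auto
  show ?thesis
    unfolding t_statistic_def by measurable
qed

lemma (in prob_space) indep_vars_reindex:
  assumes indep: "indep_vars M' X (f ` I)" and inj: "inj_on f I"
  shows "indep_vars (\<lambda>i. M' (f i)) (\<lambda>i. X (f i)) I"
  unfolding indep_vars_def2
proof (intro conjI ballI indep_setsI)
  fix i assume "i \<in> I"
  then show rv: "random_variable (M' (f i)) (X (f i))"
    using indep by (simp add: indep_vars_def2)
  then show "{X (f i) -` A \<inter> space M | A. A \<in> sets (M' (f i))} \<subseteq> events"
    by auto
next
  fix A J
  assume J: "J \<noteq> {}" "J \<subseteq> I" "finite J"
    and A: "\<forall>j\<in>J. A j \<in> {X (f j) -` B \<inter> space M | B. B \<in> sets (M' (f j))}"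
  have inj_J: "inj_on f J" using inj J(2) by (rule inj_on_subset)
  define A' where "A' = A \<circ> the_inv_into J f"
  have A': "A' (f j) = A j" if "j \<in> J" for j
    using the_inv_into_f_f[OF inj_J that] by (simp add: A'_def)
  have "prob (\<Inter>k\<in>f ` J. A' k) = (\<Prod>k\<in>f ` J. prob (A' k))"
    using indep J A A' unfolding indep_vars_def2
    by (intro indep_setsD[where F = "\<lambda>i. {X i -` B \<inter> space M | B. B \<in> sets (M' i)}" and I = "f ` I"])
       auto
  moreover have "(\<Inter>k\<in>f ` J. A' k) = (\<Inter>j\<in>J. A j)"
    using A' by simp
  moreover have "(\<Prod>k\<in>f ` J. prob (A' k)) = (\<Prod>j\<in>J. prob (A j))"
    using A' by (simp add: prod.reindex[OF inj_J])
  ultimately show "prob (\<Inter>j\<in>J. A j) = (\<Prod>j\<in>J. prob (A j))" by simp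
qed

text \<open>Any \<open>n\<close> observations with distinct indices have the \<open>n\<close>-fold
  product of \<open>F\<close> as joint law, and integrability of a function of them depends on that
  law alone.\<close>

lemma (in prob_space) integrable_t_statistic_reindex:
  fixes X :: "nat \<Rightarrow> 'a \<Rightarrow> real" and f :: "real \<Rightarrow> real"
  assumes indep: "indep_vars (\<lambda>_. borel) X I"
    and distr: "\<And>i. i \<in> I \<Longrightarrow> distr M borel (X i) = F"
    and n: "n \<ge> 1" and I: "{1..n} \<subseteq> I"
    and \<sigma>: "inj_on \<sigma> {1..n}" "\<sigma> ` {1..n} \<subseteq> I"
    and f [measurable]: "f \<in> borel_measurable borel"
    and int: "integrable M (\<lambda>\<omega>. f (t_statistic n (\<lambda>i. X i \<omega>)))"
  shows "integrable M (\<lambda>\<omega>. f (t_statistic n (\<lambda>i. X (\<sigma> i) \<omega>)))"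
proof -
  let ?P = "PiM {1..n} (\<lambda>_. borel :: real measure)"
  let ?h = "\<lambda>x. f (t_statistic n x)"
  have h: "?h \<in> borel_measurable ?P"
    by (intro measurable_compose[OF _ f] measurable_t_statistic) simp
  have law: "(\<lambda>\<omega>. \<lambda>i\<in>{1..n}. X (\<tau> i) \<omega>) \<in> M \<rightarrow>\<^sub>M ?P
      \<and> distr M ?P (\<lambda>\<omega>. \<lambda>i\<in>{1..n}. X (\<tau> i) \<omega>) = PiM {1..n} (\<lambda>_. F)"
    if \<tau>: "inj_on \<tau> {1..n}" "\<tau> ` {1..n} \<subseteq> I" for \<tau>
  proof -
    have rv: "random_variable borel (X (\<tau> i))" if "i \<in> {1..n}" for i
      using indep \<tau>(2) that unfolding indep_vars_def by blast
    have "indep_vars (\<lambda>_. borel) X (\<tau> ` {1..n})"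
      using indep_vars_subset[OF indep \<tau>(2)] .
    then have ind: "indep_vars (\<lambda>_. borel) (\<lambda>i. X (\<tau> i)) {1..n}"
      using indep_vars_reindex \<tau>(1) by fastforce
    have "distr M ?P (\<lambda>\<omega>. \<lambda>i\<in>{1..n}. X (\<tau> i) \<omega>) = PiM {1..n} (\<lambda>i. distr M borel (X (\<tau> i)))"
      using indep_vars_iff_distr_eq_PiM'[of "{1..n}" "\<lambda>i. X (\<tau> i)" "\<lambda>_. borel"] rv ind n by simp
    also have "\<dots> = PiM {1..n} (\<lambda>_. F)"
      using distr \<tau>(2) by (intro PiM_cong) (simp_all add: image_subset_iff)
    finally show ?thesis
      using rv by (auto intro!: measurable_restrict)
  qed
  have transfer: "integrable M (\<lambda>\<omega>. ?h (\<lambda>i. X (\<tau> i) \<omega>)) \<longleftrightarrow>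
      integrable (distr M ?P (\<lambda>\<omega>. \<lambda>i\<in>{1..n}. X (\<tau> i) \<omega>)) ?h"
    if "inj_on \<tau> {1..n}" "\<tau> ` {1..n} \<subseteq> I" for \<tau>
  proof -
    \<comment> \<open>Points of the product space are \<open>undefined\<close> outside
      \<open>{1..n}\<close>, where the statistic does not look.\<close>
    have "t_statistic n (\<lambda>i\<in>{1..n}. X (\<tau> i) \<omega>) = t_statistic n (\<lambda>i. X (\<tau> i) \<omega>)" for \<omega>
      by (rule t_statistic_cong) simp
    then show ?thesis
      using law[OF that] h by (subst integrable_distr_eq) auto
  qed
  show ?thesis
    using transfer[OF \<sigma>] transfer[of "\<lambda>i. i"] law[OF \<sigma>] law[of "\<lambda>i. i"] I int by simp
qed

section \<open>Integrability by domination\<close>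

theorem theorem4p1:
  fixes M :: "'a measure" and F :: "real measure"
    and X :: "nat \<Rightarrow> 'a \<Rightarrow> real" and n :: nat and r :: real
  assumes "prob_space M"
    and "prob_space.indep_vars M (\<lambda>_. borel) X {1..}"
    and "\<And>i. i \<ge> 1 \<Longrightarrow> distr M borel (X i) = F"
    and "n \<ge> 2" and "r > 0"
    and "integrable M (\<lambda>\<omega>. \<bar>t_statistic n (\<lambda>i. X i \<omega>)\<bar> powr r)"
  shows "integrable M (\<lambda>\<omega>. \<bar>t_statistic (n + 1) (\<lambda>i. X i \<omega>)\<bar> powr r)"
proof -
  interpret prob_space M by fact
  note n = \<open>n \<ge> 2\<close> and r = \<open>r > 0\<close>
  have rv: "X i \<in> borel_measurable M" if "i \<ge> 1" for i
    using assms(2) that unfolding indep_vars_def by simp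
  \<comment> \<open>This is the index form of the update at slot 1; it is injective on
    \<open>{1..n}\<close> because \<open>n + 1\<close> lies outside.\<close>
  define \<sigma> where "\<sigma> = (\<lambda>i :: nat. if i = 1 then n + 1 else i)"
  define T where "T = (\<lambda>\<omega>. t_statistic n (\<lambda>i. X i \<omega>))"
  define T' where "T' = (\<lambda>\<omega>. t_statistic n (\<lambda>i. X (\<sigma> i) \<omega>))"
  have T: "integrable M (\<lambda>\<omega>. \<bar>T \<omega>\<bar> powr r)"
    using assms(6) by (simp add: T_def)
  have T': "integrable M (\<lambda>\<omega>. \<bar>T' \<omega>\<bar> powr r)"
    unfolding T'_def
    by (rule integrable_t_statistic_reindex[OF assms(2), where F = F and f = "\<lambda>t. \<bar>t\<bar> powr r"])
       (use assms in \<open>auto simp: \<sigma>_def inj_on_def split: if_splits\<close>)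
  define B where "B = (\<lambda>\<omega>. (2 * real (n + 1)) powr r * (1 + \<bar>T \<omega>\<bar> powr r + \<bar>T' \<omega>\<bar> powr r))"
  have bound: "\<bar>t_statistic (n + 1) (\<lambda>i. X i \<omega>)\<bar> powr r \<le> B \<omega>" for \<omega>
  proof -
    \<comment> \<open>Including 1 in the maximum gives \<open>1 + max \<bar>T \<omega>\<bar>
      \<bar>T' \<omega>\<bar> \<le> 2 * K\<close>, and \<open>K powr r\<close> is one of the three
      summands in \<open>B\<close>. This treats all \<open>r > 0\<close> alike, with no convexity
      argument.\<close>
    define K where "K = max 1 (max \<bar>T \<omega>\<bar> \<bar>T' \<omega>\<bar>)"
    have "(\<lambda>i. X i \<omega>)(1 := X (n + 1) \<omega>) = (\<lambda>i. X (\<sigma> i) \<omega>)"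
      by (auto simp: \<sigma>_def)
    then have "\<bar>t_statistic (n + 1) (\<lambda>i. X i \<omega>)\<bar> \<le> real (n + 1) * (1 + max \<bar>T \<omega>\<bar> \<bar>T' \<omega>\<bar>)"
      using t_statistic_Suc_le[OF n, of "\<lambda>i. X i \<omega>"] by (simp add: T_def T'_def)
    also have "\<dots> \<le> real (n + 1) * (2 * K)"
      by (intro mult_left_mono) (auto simp: K_def)
    finally have "\<bar>t_statistic (n + 1) (\<lambda>i. X i \<omega>)\<bar> powr r \<le> (2 * real (n + 1) * K) powr r"
      using r by (intro powr_mono2) (auto simp: mult_ac)
    also have "\<dots> = (2 * real (n + 1)) powr r * K powr r"
      by (rule powr_mult)
    also have "K powr r \<le> 1 + \<bar>T \<omega>\<bar> powr r + \<bar>T' \<omega>\<bar> powr r"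
      by (auto simp: K_def max_def)
    finally show ?thesis by (simp add: B_def mult_left_mono)
  qed
  have "integrable M B"
    unfolding B_def using T T' by simp
  then show ?thesis
  proof (rule Bochner_Integration.integrable_bound)
    have "(\<lambda>\<omega>. t_statistic (n + 1) (\<lambda>i. X i \<omega>)) \<in> borel_measurable M"
      by (rule measurable_t_statistic) (use rv in auto)
    then show "(\<lambda>\<omega>. \<bar>t_statistic (n + 1) (\<lambda>i. X i \<omega>)\<bar> powr r) \<in> borel_measurable M"
      by simp
    show "AE \<omega> in M. norm (\<bar>t_statistic (n + 1) (\<lambda>i. X i \<omega>)\<bar> powr r) \<le> norm (B \<omega>)"
      using order_trans[OF bound abs_ge_self] by simp
  qed
qed

end
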